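(* Let $d\ge2$ be an integer and $m>1$ real. Suppose that $x_1,\dots,x_d$ are real numbers satisfying $\prod_{k=1}^d\sqrt{1+x_k^2}=m$ for which $\Delta=\prod_{1\le j<k\le d}(x_j-x_k)^2$ is maximal among all collections of $d$ real numbers satisfying this constraint. Write $$f(x)=(x-x_1)\cdots(x-x_d)=x^d+c_{d-1}x^{d-1}+\dots+c_0,\qquad c_d=1.$$ Then there is $\lambda\in\mathbb{R}$ such that $$(\lambda-2d+2)\,c_{d-1}=0$$ and $$(k+1)(k+2)\,c_{k+2}=(d-k)(d+k-1-\lambda)\,c_k,\qquad k=0,\dots,d-2.$$ *)

theory Defs
  imports Complex_Main "HOL-Computational_Algebra.Polynomial"
begin

text \<open>
  A collection of \<open>d\<close> real numbers \<open>x\<^sub>1, \<dots>, x\<^sub>d\<close> is a function of type \<open>nat \<Rightarrow> real\<close> of which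
  only the values on \<open>{1..d}\<close> matter.
\<close>

definition admissible :: "nat \<Rightarrow> real \<Rightarrow> (nat \<Rightarrow> real) \<Rightarrow> bool" where
  "admissible d m x \<longleftrightarrow> (\<Prod>k=1..d. sqrt (1 + (x k)\<^sup>2)) = m"

definition Delta :: "nat \<Rightarrow> (nat \<Rightarrow> real) \<Rightarrow> real" where
  "Delta d x = (\<Prod>(j, k) \<in> {(j, k). 1 \<le> j \<and> j < k \<and> k \<le> d}. (x j - x k)\<^sup>2)"

end

theory Submission
  imports Defs
begin

text \<open>
  Since \<open>m > 1\<close>, some \<open>x\<^sub>p\<close> is nonzero. Moving any other coordinate \<open>x\<^sub>q\<close> freely and restoring the
  constraint by means of \<open>x\<^sub>p\<close> gives a differentiable curve of admissible points through \<open>x\<close>, so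
  the derivative of \<open>\<Delta>\<close> along it vanishes. This is the Lagrange condition
  \<open>\<Sum>\<^sub>l\<^sub>\<noteq>\<^sub>j 1 / (x\<^sub>j - x\<^sub>l) = (\<lambda>/2) x\<^sub>j / (1 + x\<^sub>j\<^sup>2)\<close> for all \<open>j\<close>. Its left-hand side is
  \<open>f''(x\<^sub>j) / (2 f'(x\<^sub>j))\<close>, so the polynomial \<open>(1 + X\<^sup>2) f'' - \<lambda> X f'\<close>, of degree at most \<open>d\<close>,
  vanishes at the \<open>d\<close> distinct roots of \<open>f\<close> and is a constant multiple of \<open>f\<close>. Comparing
  coefficients gives the claim.
\<close>

section \<open>Logarithmic derivatives of products, of the discriminant, and of f at its
  roots\<close>

lemma has_real_derivative_prod_log:
  fixes h :: "'i \<Rightarrow> real \<Rightarrow> real"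
  assumes "finite I"
    and "\<And>i. i \<in> I \<Longrightarrow> (h i has_real_derivative h' i) (at t)"
    and "\<And>i. i \<in> I \<Longrightarrow> h i t \<noteq> 0"
  shows "((\<lambda>u. \<Prod>i\<in>I. h i u) has_real_derivative (\<Prod>i\<in>I. h i t) * (\<Sum>i\<in>I. h' i / h i t)) (at t)"
  using assms
proof (induction I rule: finite_induct)
  case empty
  then show ?case by simp
next
  case (insert i I)
  have "((\<lambda>u. h i u * (\<Prod>i\<in>I. h i u)) has_real_derivative
      h' i * (\<Prod>i\<in>I. h i t) + (\<Prod>i\<in>I. h i t) * (\<Sum>i\<in>I. h' i / h i t) * h i t) (at t)"
    by (rule DERIV_mult) (use insert in auto)
  moreover have "h' i * P + P * S * h i t = h i t * P * (h' i / h i t + S)" for P S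
    using insert.prems(2)[of i] by (simp add: field_simps)
  ultimately show ?case using insert.hyps by simp
qed

text \<open>For distinct points this is half the partial derivative of log \<open>Delta\<close> with
  respect to \<open>x j\<close>.\<close>

definition pole_sum :: "nat \<Rightarrow> (nat \<Rightarrow> real) \<Rightarrow> nat \<Rightarrow> real" where
  "pole_sum d x j = (\<Sum>l\<in>{1..d} - {j}. 1 / (x j - x l))"

lemma finite_index_pairs: "finite {(j, k). 1 \<le> j \<and> j < k \<and> k \<le> (d::nat)}"
  by (rule finite_subset[of _ "{1..d} \<times> {1..d}"]) auto

lemma Delta_nonneg: "Delta d x \<ge> 0"
  unfolding Delta_def by (rule prod_nonneg) auto

lemma Delta_nonzero_iff: "Delta d x \<noteq> 0 \<longleftrightarrow> inj_on x {1..d}"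
proof -
  have "Delta d x \<noteq> 0 \<longleftrightarrow> (\<forall>j k. 1 \<le> j \<and> j < k \<and> k \<le> d \<longrightarrow> x j \<noteq> x k)"
    unfolding Delta_def using finite_index_pairs[of d] by (auto simp: prod_zero_iff)
  also have "\<dots> \<longleftrightarrow> inj_on x {1..d}"
  proof
    assume L: "\<forall>j k. 1 \<le> j \<and> j < k \<and> k \<le> d \<longrightarrow> x j \<noteq> x k"
    show "inj_on x {1..d}"
    proof (rule inj_onI)
      fix j k assume "j \<in> {1..d}" "k \<in> {1..d}" "x j = x k"
      then show "j = k" using L by (cases j k rule: linorder_cases) (auto, metis)
    qed
  next
    assume "inj_on x {1..d}"
    then show "\<forall>j k. 1 \<le> j \<and> j < k \<and> k \<le> d \<longrightarrow> x j \<noteq> x k"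
      by (auto dest: inj_onD)
  qed
  finally show ?thesis .
qed

text \<open>The right-hand side runs over ordered pairs of different indices. Swapping the two
  indices in the pairs with \<open>k < j\<close> merges the two orders of each pair into one
  difference quotient.\<close>

lemma sum_pairs_diff_quotient:
  "(\<Sum>(j, k) \<in> {(j, k). 1 \<le> j \<and> j < k \<and> k \<le> d}. (v j - v k) / (x j - x k))
    = (\<Sum>j=1..d. v j * pole_sum d x j)"
proof -
  let ?L = "{(j, k). 1 \<le> j \<and> j < k \<and> k \<le> d}"
  let ?G = "{(j, k). 1 \<le> k \<and> k < j \<and> j \<le> d}"
  let ?t = "\<lambda>(j, k). v j / (x j - x k)"
  have fin: "finite ?L" "finite ?G"
    by (rule finite_index_pairs, rule finite_subset[of _ "{1..d} \<times> {1..d}"]) auto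
  have "(\<Sum>j=1..d. v j * pole_sum d x j) = (\<Sum>j=1..d. \<Sum>l\<in>{1..d} - {j}. v j / (x j - x l))"
    by (simp add: pole_sum_def sum_distrib_left)
  also have "\<dots> = sum ?t (SIGMA j:{1..d}. {1..d} - {j})"
    by (subst sum.Sigma) auto
  also have "(SIGMA j:{1..d}. {1..d} - {j}) = ?L \<union> ?G" by auto
  also have "sum ?t (?L \<union> ?G) = sum ?t ?L + sum ?t ?G"
    by (rule sum.union_disjoint) (use fin in auto)
  also have "sum ?t ?G = (\<Sum>(j, k)\<in>?L. v k / (x k - x j))"
    by (rule sum.reindex_bij_witness[of _ "\<lambda>(j, k). (k, j)" "\<lambda>(j, k). (k, j)"]) auto
  also have "sum ?t ?L + \<dots> = (\<Sum>(j, k)\<in>?L. v j / (x j - x k) + v k / (x k - x j))"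
    by (simp add: sum.distrib case_prod_unfold)
  also have "\<dots> = (\<Sum>(j, k)\<in>?L. (v j - v k) / (x j - x k))"
  proof (rule sum.cong[OF refl], clarsimp)
    fix j k
    have "v k / (x k - x j) = - (v k / (x j - x k))"
      by (metis minus_diff_eq divide_minus_right)
    then show "v j / (x j - x k) + v k / (x k - x j) = (v j - v k) / (x j - x k)"
      by (simp add: diff_divide_distrib)
  qed
  finally show ?thesis by simp
qed

text \<open>Logarithmic differentiation: the squared factor of the pair \<open>(j, k)\<close>
  contributes \<open>2 * (v j - v k) / (y j t - y k t)\<close>, and these quotients are then
  regrouped by coordinate.\<close>

lemma Delta_has_real_derivative:
  assumes inj: "inj_on (\<lambda>j. y j t) {1..d}"
    and der: "\<And>j. j \<in> {1..d} \<Longrightarrow> (y j has_real_derivative v j) (at t)"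
  shows "((\<lambda>u. Delta d (\<lambda>j. y j u)) has_real_derivative
    Delta d (\<lambda>j. y j t) * (2 * (\<Sum>j=1..d. v j * pole_sum d (\<lambda>j. y j t) j))) (at t)"
proof -
  let ?L = "{(j, k). 1 \<le> j \<and> j < k \<and> k \<le> d}"
  let ?h = "\<lambda>(j, k) u. (y j u - y k u)\<^sup>2"
  let ?h' = "\<lambda>(j, k). 2 * (y j t - y k t) * (v j - v k)"
  have ne: "y j t \<noteq> y k t" if "(j, k) \<in> ?L" for j k
    using inj_onD[OF inj, of j k] that by auto
  have "((\<lambda>u. \<Prod>i\<in>?L. ?h i u) has_real_derivative
      (\<Prod>i\<in>?L. ?h i t) * (\<Sum>i\<in>?L. ?h' i / ?h i t)) (at t)"
  proof (rule has_real_derivative_prod_log[OF finite_index_pairs])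
    fix i assume i: "i \<in> ?L"
    obtain j k where jk: "i = (j, k)" by (cases i)
    have "(y j has_real_derivative v j) (at t)" "(y k has_real_derivative v k) (at t)"
      using i jk by (auto intro!: der)
    then show "(?h i has_real_derivative ?h' i) (at t)"
      unfolding jk by (auto intro!: derivative_eq_intros)
    show "?h i t \<noteq> 0" using ne i jk by auto
  qed
  moreover have "(\<Sum>i\<in>?L. ?h' i / ?h i t) = 2 * (\<Sum>(j, k)\<in>?L. (v j - v k) / (y j t - y k t))"
  proof -
    have quot: "2 * z * w / z\<^sup>2 = 2 * (w / z)" if "z \<noteq> 0" for z w :: real
      using that by (simp add: power2_eq_square)
    have "?h' i / ?h i t = 2 * (case i of (j, k) \<Rightarrow> (v j - v k) / (y j t - y k t))" if "i \<in> ?L" for i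
    proof (cases i)
      case (Pair j k)
      then have "y j t - y k t \<noteq> 0" using ne that by auto
      then show ?thesis unfolding Pair prod.case by (rule quot)
    qed
    then show ?thesis unfolding sum_distrib_left by (intro sum.cong refl)
  qed
  ultimately show ?thesis
    unfolding sum_pairs_diff_quotient Delta_def by (simp add: case_prod_unfold)
qed

text \<open>Splitting off one root as f = (X - x_j) g gives f'(x_j) = g(x_j) and f''(x_j) = 2
  g'(x_j), and the logarithmic derivative of g at x_j is \<open>pole_sum d x j\<close>.\<close>

lemma poly_pderiv_pderiv_prod_roots:
  fixes x :: "nat \<Rightarrow> real"
  assumes inj: "inj_on x {1..d}" and j: "j \<in> {1..d}"
    and f: "f = (\<Prod>k=1..d. [:- x k, 1:])"
  shows "poly (pderiv (pderiv f)) (x j) = 2 * poly (pderiv f) (x j) * pole_sum d x j"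
proof -
  define g where "g = (\<Prod>k\<in>{1..d} - {j}. [:- x k, 1:])"
  have fg: "f = [:- x j, 1:] * g"
    unfolding f g_def using j by (subst prod.remove[of _ j]) auto
  have "((\<lambda>u. \<Prod>k\<in>{1..d} - {j}. u - x k) has_real_derivative
      (\<Prod>k\<in>{1..d} - {j}. x j - x k) * (\<Sum>k\<in>{1..d} - {j}. 1 / (x j - x k))) (at (x j))"
    by (rule has_real_derivative_prod_log)
      (use inj_onD[OF inj] j in \<open>auto intro!: derivative_eq_intros\<close>)
  then have "(poly g has_real_derivative poly g (x j) * pole_sum d x j) (at (x j))"
    unfolding g_def pole_sum_def by (simp add: poly_prod[abs_def] fun_eq_iff)
  then have "poly (pderiv g) (x j) = poly g (x j) * pole_sum d x j"
    using DERIV_unique poly_DERIV by blast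
  then show ?thesis
    unfolding fg by (simp add: pderiv_mult pderiv_pCons pderiv_add pderiv_smult pderiv_diff algebra_simps)
qed

section \<open>Maximality: distinct points and the Lagrange condition\<close>

lemma admissible_inj_exists:
  assumes "d \<ge> 1" and "m > 1"
  shows "\<exists>y. admissible d m y \<and> inj_on y {1..d}"
proof -
  \<comment> \<open>The witness is an arithmetic progression s, 2s, ..., ds. The product
    \<open>?F\<close> is 1 at s = 0, and at s = m its first factor alone is at least m, so some s
    between gives exactly m.\<close>
  let ?F = "\<lambda>s. \<Prod>k=1..d. sqrt (1 + (s * real k)\<^sup>2)"
  have "sqrt (1 + m\<^sup>2) \<le> ?F m"
  proof -
    have "?F m = sqrt (1 + (m * real 1)\<^sup>2) * (\<Prod>k\<in>{1..d} - {1}. sqrt (1 + (m * real k)\<^sup>2))"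
      using assms(1) by (subst prod.remove[of _ 1]) auto
    moreover have "(\<Prod>k\<in>{1..d} - {1}. sqrt (1 + (m * real k)\<^sup>2)) \<ge> 1"
      by (rule prod_ge_1) auto
    ultimately show ?thesis
      using mult_left_mono[of 1 _ "sqrt (1 + m\<^sup>2)"] by simp
  qed
  moreover have "m \<le> sqrt (1 + m\<^sup>2)"
    by (rule real_le_rsqrt) simp
  ultimately have "m \<le> ?F m" by simp
  moreover have "?F 0 \<le> m" using assms(2) by simp
  moreover have "continuous_on {0..m} ?F"
    by (intro continuous_intros)
  ultimately obtain s where s: "s \<ge> 0" "?F s = m"
    using IVT'[of ?F 0 m m] assms(2) by auto
  have "s \<noteq> 0" using s assms(2) by auto
  then have "inj_on (\<lambda>k. s * real k) {1..d}" by (auto simp: inj_on_def)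
  then show ?thesis using s(2)
    unfolding admissible_def by (intro exI[of _ "\<lambda>k. s * real k"] conjI)
qed

text \<open>A competitor with distinct coordinates has positive \<open>Delta\<close>, which forces
  the maximum to be positive as well.\<close>

lemma maximal_imp_inj:
  assumes "d \<ge> 1" and "m > 1"
    and max: "\<And>y. admissible d m y \<Longrightarrow> Delta d y \<le> Delta d x"
  shows "inj_on x {1..d}"
proof -
  obtain y where y: "admissible d m y" "inj_on y {1..d}"
    using admissible_inj_exists assms by blast
  then have "Delta d y > 0"
    using Delta_nonneg[of d y] Delta_nonzero_iff[of d y] by linarith
  then show ?thesis using max[OF y(1)] Delta_nonzero_iff[of d x] by linarith
qed

text \<open>With \<open>p\<close> held fixed, the factor in front of
  \<open>x q / (1 + (x q)\<^sup>2)\<close> is the same for every \<open>q\<close>; twice this factor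
  will be the multiplier. That \<open>x p\<close> is nonzero allows the constraint to be solved
  differentiably for coordinate \<open>p\<close>.\<close>

lemma critical_pair:
  assumes adm: "admissible d m x" and inj: "inj_on x {1..d}"
    and max: "\<And>y. admissible d m y \<Longrightarrow> Delta d y \<le> Delta d x"
    and p: "p \<in> {1..d}" and q: "q \<in> {1..d}" and xp: "x p \<noteq> 0"
  shows "pole_sum d x q = pole_sum d x p * (1 + (x p)\<^sup>2) / x p * (x q / (1 + (x q)\<^sup>2))"
proof (cases "p = q")
  case True
  have "1 + (x q)\<^sup>2 \<noteq> 0" using add_pos_nonneg[OF zero_less_one zero_le_power2, of "x q"] by simp
  then show ?thesis using xp True by simp
next
  case False
  define a b where "a = x p" and "b = x q"
  have a0: "a \<noteq> 0" using xp a_def by simp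
  have pos: "1 + u\<^sup>2 > 0" for u :: real by (simp add: add_pos_nonneg)
  have ne: "1 + u\<^sup>2 \<noteq> 0" for u :: real using pos[of u] by simp
  \<comment> \<open>When coordinate \<open>q\<close> equals t, the constraint makes
    \<open>R t\<close> the square of coordinate \<open>p\<close>. The sign in \<open>s\<close>
    selects the branch through a, and \<open>s'\<close> is the slope of that branch at b.\<close>
  define R where "R = (\<lambda>t. (1 + a\<^sup>2) * (1 + b\<^sup>2) / (1 + t\<^sup>2) - 1)"
  define s where "s = (\<lambda>t. sgn a * sqrt (R t))"
  define s' where "s' = - ((1 + a\<^sup>2) * b / (a * (1 + b\<^sup>2)))"
  define y where "y = (\<lambda>j t. if j = q then t else if j = p then s t else x j)"
  have Rb: "R b = a\<^sup>2" unfolding R_def using ne[of b] by simp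
  have sb: "s b = a" unfolding s_def Rb by (simp add: sgn_mult_abs)
  have yb: "y j b = x j" for j using sb by (auto simp: y_def a_def b_def)
  have "(R has_real_derivative (1 + a\<^sup>2) * (1 + b\<^sup>2) * (- 2 * b) / (1 + b\<^sup>2)\<^sup>2) (at b)"
    unfolding R_def using ne[of b]
    by (auto intro!: derivative_eq_intros simp: power2_eq_square)
  then have dR: "(R has_real_derivative - 2 * (1 + a\<^sup>2) * b / (1 + b\<^sup>2)) (at b)"
  proof (rule DERIV_cong)
    have "A * B * (- 2 * b) / B\<^sup>2 = - 2 * A * b / B" if "B \<noteq> 0" for A B :: real
      using that by (simp add: power2_eq_square)
    then show "(1 + a\<^sup>2) * (1 + b\<^sup>2) * (- 2 * b) / (1 + b\<^sup>2)\<^sup>2 = - 2 * (1 + a\<^sup>2) * b / (1 + b\<^sup>2)"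
      using ne[of b] .
  qed
  have "R b > 0" using Rb a0 by simp
  have "(s has_real_derivative sgn a * (inverse (sqrt (R b)) / 2 * (- 2 * (1 + a\<^sup>2) * b / (1 + b\<^sup>2)))) (at b)"
    unfolding s_def by (rule DERIV_cmult[OF DERIV_chain2[OF DERIV_real_sqrt[OF \<open>R b > 0\<close>] dR]])
  then have ds: "(s has_real_derivative s') (at b)"
  proof (rule DERIV_cong)
    have "sgn a * (inverse \<bar>a\<bar> / 2 * (- 2 * K * b / B)) = - (K * b / (a * B))" for K B :: real
      using a0 by (cases "a > 0") (auto simp: inverse_eq_divide)
    then show "sgn a * (inverse (sqrt (R b)) / 2 * (- 2 * (1 + a\<^sup>2) * b / (1 + b\<^sup>2))) = s'"
      unfolding Rb s'_def real_sqrt_abs .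
  qed
  have adm_y: "admissible d m (\<lambda>j. y j t)" if "R t > 0" for t
  proof -
    have split: "(\<Prod>k=1..d. h k) = h q * h p * (\<Prod>k\<in>{1..d} - {q} - {p}. h k)" for h :: "nat \<Rightarrow> real"
      using p q False by (subst prod.remove[of _ q], simp, simp, subst prod.remove[of _ p]) (auto simp: mult.assoc)
    have s2: "1 + (s t)\<^sup>2 = (1 + a\<^sup>2) * (1 + b\<^sup>2) / (1 + t\<^sup>2)"
    proof -
      have "(s t)\<^sup>2 = R t" using a0 that by (auto simp: s_def power_mult_distrib sgn_if)
      then show ?thesis by (simp add: R_def)
    qed
    have "(\<Prod>k\<in>{1..d} - {q} - {p}. sqrt (1 + (y k t)\<^sup>2)) = (\<Prod>k\<in>{1..d} - {q} - {p}. sqrt (1 + (x k)\<^sup>2))"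
      by (rule prod.cong) (auto simp: y_def)
    moreover have "sqrt (1 + (y q t)\<^sup>2) * sqrt (1 + (y p t)\<^sup>2) = sqrt (1 + (x q)\<^sup>2) * sqrt (1 + (x p)\<^sup>2)"
    proof -
      have "(1 + t\<^sup>2) * (1 + (s t)\<^sup>2) = (1 + b\<^sup>2) * (1 + a\<^sup>2)"
        unfolding s2 using ne[of t] by simp
      then show ?thesis
        using False by (simp add: y_def a_def b_def flip: real_sqrt_mult)
    qed
    ultimately show ?thesis
      using adm unfolding admissible_def split by simp
  qed
  define v where "v = (\<lambda>j. if j = q then 1 else if j = p then s' else 0)"
  have "(y j has_real_derivative v j) (at b)" for j
    unfolding y_def v_def using ds by auto
  then have D: "((\<lambda>u. Delta d (\<lambda>j. y j u)) has_real_derivative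
      Delta d x * (2 * (\<Sum>j=1..d. v j * pole_sum d x j))) (at b)"
    using Delta_has_real_derivative[of y b d v] inj by (simp add: yb)
  \<comment> \<open>Since \<open>R b\<close> is the positive number \<open>a\<^sup>2\<close>, the
    curve stays admissible near b, which suffices for a local maximum.\<close>
  have "\<forall>\<^sub>F t in at b. R t > 0"
    using order_tendstoD(1)[OF DERIV_isCont[OF dR, unfolded isCont_def] \<open>R b > 0\<close>] .
  then obtain e where e: "e > 0" "\<And>t. t \<noteq> b \<Longrightarrow> dist t b < e \<Longrightarrow> R t > 0"
    unfolding eventually_at by auto
  have "\<forall>t. \<bar>b - t\<bar> < e \<longrightarrow> Delta d (\<lambda>j. y j t) \<le> Delta d (\<lambda>j. y j b)"
  proof (intro allI impI)
    fix t assume "\<bar>b - t\<bar> < e"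
    then have "R t > 0" using e(2)[of t] \<open>R b > 0\<close> by (cases "t = b") (auto simp: dist_real_def)
    then show "Delta d (\<lambda>j. y j t) \<le> Delta d (\<lambda>j. y j b)"
      using max[OF adm_y] by (simp add: yb)
  qed
  then have "Delta d x * (2 * (\<Sum>j=1..d. v j * pole_sum d x j)) = 0"
    by (rule DERIV_local_max[OF D e(1)])
  then have "(\<Sum>j=1..d. v j * pole_sum d x j) = 0"
    using inj Delta_nonzero_iff[of d x] by simp
  moreover have "(\<Sum>j=1..d. v j * pole_sum d x j) = pole_sum d x q + s' * pole_sum d x p"
  proof -
    have "(\<Sum>j=1..d. v j * pole_sum d x j) = (\<Sum>j\<in>{p, q}. v j * pole_sum d x j)"
      by (rule sum.mono_neutral_right) (use p q in \<open>auto simp: v_def\<close>)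
    then show ?thesis using False by (simp add: v_def)
  qed
  ultimately have "pole_sum d x q = - s' * pole_sum d x p" by simp
  also have "\<dots> = pole_sum d x p * (1 + a\<^sup>2) / a * (b / (1 + b\<^sup>2))"
    unfolding s'_def by (simp add: mult_ac)
  finally show ?thesis unfolding a_def b_def .
qed

text \<open>If all coordinates vanished, the constraint product would be 1, contrary to m > 1. So a
  nonzero coordinate \<open>x p\<close> is available as the reference for all indices, and clearing
  denominators gives the stated form.\<close>

lemma lagrange_multiplier:
  assumes "d \<ge> 1" and "m > 1" and adm: "admissible d m x"
    and max: "\<And>y. admissible d m y \<Longrightarrow> Delta d y \<le> Delta d x"
  obtains lam where "\<And>j. j \<in> {1..d} \<Longrightarrow> 2 * (1 + (x j)\<^sup>2) * pole_sum d x j = lam * x j"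
proof -
  have inj: "inj_on x {1..d}" using maximal_imp_inj[OF assms(1,2) max] .
  obtain p where p: "p \<in> {1..d}" "x p \<noteq> 0"
  proof (rule ccontr)
    assume "\<not> thesis"
    then have "\<And>k. k \<in> {1..d} \<Longrightarrow> x k = 0" using that by blast
    then have "(\<Prod>k=1..d. sqrt (1 + (x k)\<^sup>2)) = 1" by simp
    then show False using adm \<open>m > 1\<close> by (simp add: admissible_def)
  qed
  show thesis
  proof (rule that)
    fix j assume j: "j \<in> {1..d}"
    have cancel: "2 * A * (K * (X / A)) = 2 * K * X" if "A \<noteq> 0" for A K X :: real
      using that by simp
    have "1 + (x j)\<^sup>2 \<noteq> 0"
      using add_pos_nonneg[OF zero_less_one zero_le_power2, of "x j"] by simp
    have eq: "pole_sum d x j = pole_sum d x p * (1 + (x p)\<^sup>2) / x p * (x j / (1 + (x j)\<^sup>2))"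
      by (rule critical_pair[OF adm inj _ p(1) j p(2)]) (rule max)
    show "2 * (1 + (x j)\<^sup>2) * pole_sum d x j = (2 * (pole_sum d x p * (1 + (x p)\<^sup>2) / x p)) * x j"
      unfolding eq by (rule cancel) fact
  qed
qed

section \<open>The differential equation for f and its coefficients\<close>

lemma degree_prod_linear: "degree (\<Prod>k=1..d. [:- x k, 1:] :: real poly) = d"
  by (subst degree_prod_eq_sum_degree) auto

lemma coeff_ode:
  fixes f :: "real poly"
  shows "coeff ([:1, 0, 1:] * pderiv (pderiv f) - smult lam ([:0, 1:] * pderiv f) - smult C f) k =
    (real k + 1) * (real k + 2) * coeff f (k + 2) + (real k * (real k - 1) - lam * real k - C) * coeff f k"
proof -
  \<comment> \<open>Multiplication by X and by X^2 shifts coefficients, so the two lowest indices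
    are treated apart.\<close>
  consider "k = 0" | "k = 1" | n where "k = Suc (Suc n)"
    by (metis One_nat_def not0_implies_Suc)
  then show ?thesis
    by cases (auto simp: coeff_pderiv algebra_simps numeral_2_eq_2)
qed

theorem theorem12:
  fixes d :: nat and m :: real and x :: "nat \<Rightarrow> real"
    and f :: "real poly" and c :: "nat \<Rightarrow> real"
  assumes "d \<ge> 2" and "m > 1"
    and "admissible d m x"
    and "\<And>y. admissible d m y \<Longrightarrow> Delta d y \<le> Delta d x"
    and "f = (\<Prod>k=1..d. [:- x k, 1:])"
    and "\<And>k. c k = coeff f k"
  shows "\<exists>lam::real. (lam - 2 * real d + 2) * c (d - 1) = 0 \<and>
    (\<forall>k\<in>{0..d - 2}. (real k + 1) * (real k + 2) * c (k + 2) =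
       (real d - real k) * (real d + real k - 1 - lam) * c k)"
proof -
  have d1: "d \<ge> 1" using assms(1) by simp
  have inj: "inj_on x {1..d}" using maximal_imp_inj[OF d1 assms(2,4)] .
  obtain lam where lam: "\<And>j. j \<in> {1..d} \<Longrightarrow> 2 * (1 + (x j)\<^sup>2) * pole_sum d x j = lam * x j"
    using lagrange_multiplier[OF d1 assms(2,3,4)] by blast
  \<comment> \<open>This constant makes the coefficient of X^d in \<open>P\<close> cancel, so that a
    nonzero \<open>P\<close> would have degree below d.\<close>
  define C where "C = real d * (real d - 1) - lam * real d"
  define P where "P = [:1, 0, 1:] * pderiv (pderiv f) - smult lam ([:0, 1:] * pderiv f) - smult C f"
  have deg: "degree f = d" unfolding assms(5) by (rule degree_prod_linear)
  have P_coeff: "coeff P k = (real k + 1) * (real k + 2) * coeff f (k + 2)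
      + (real k * (real k - 1) - lam * real k - C) * coeff f k" for k
    unfolding P_def by (rule coeff_ode)
  have P_high: "coeff P k = 0" if "k \<ge> d" for k
    unfolding P_coeff using that deg by (cases "k = d") (auto simp: coeff_eq_0 C_def)
  have root: "poly P (x j) = 0" if j: "j \<in> {1..d}" for j
  proof -
    have "poly f (x j) = 0" unfolding assms(5) poly_prod using j by (auto intro!: prod_zero)
    then have "poly P (x j) = (1 + (x j)\<^sup>2) * poly (pderiv (pderiv f)) (x j) - lam * x j * poly (pderiv f) (x j)"
      unfolding P_def by (simp add: power2_eq_square algebra_simps)
    also have "\<dots> = (2 * (1 + (x j)\<^sup>2) * pole_sum d x j - lam * x j) * poly (pderiv f) (x j)"
      unfolding poly_pderiv_pderiv_prod_roots[OF inj j assms(5)] by (simp add: algebra_simps)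
    finally show ?thesis using lam[OF j] by simp
  qed
  have "P = 0"
  proof (rule ccontr)
    assume "P \<noteq> 0"
    then have "degree P < d"
      using P_high[of "degree P"] leading_coeff_0_iff[of P] not_less by blast
    \<comment> \<open>The d distinct points are all roots of \<open>P\<close>, too many for a
      nonzero polynomial of degree below d.\<close>
    moreover have "card (x ` {1..d}) \<le> card {u. poly P u = 0}"
      by (rule card_mono) (use root poly_roots_finite[OF \<open>P \<noteq> 0\<close>] in auto)
    moreover have "card {u. poly P u = 0} \<le> degree P"
      by (rule card_poly_roots_bound[OF \<open>P \<noteq> 0\<close>])
    ultimately show False using card_image[OF inj] by simp
  qed
  then have rec: "(real k + 1) * (real k + 2) * c (k + 2) =
      (real d - real k) * (real d + real k - 1 - lam) * c k" for k
    using P_coeff[of k] unfolding assms(6) C_def by (simp add: algebra_simps)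
  \<comment> \<open>The first condition is the recurrence at k = d - 1: its left side vanishes, and
    the right side is (2d - 2 - lam) times \<open>c (d - 1)\<close>.\<close>
  have "c (d + 1) = 0" using deg by (simp add: assms(6) coeff_eq_0)
  moreover have "d - 1 + 2 = d + 1" "real (d - 1) = real d - 1" using d1 by auto
  ultimately have "(lam - 2 * real d + 2) * c (d - 1) = 0"
    using rec[of "d - 1"] by (simp add: algebra_simps)
  then show ?thesis using rec by blast
qed

end
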